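(* Let $\mathcal{A}$ be a C$^*$-algebra, let $P_0,\dots,P_m\in\mathcal{A}$ be fixed positive elements and let $A_0,\dots,A_m\in\mathcal{A}$. Then the equality $$\Big\|\sum_{j=0}^m A_jX_j\Big\|^2=\Big\|\sum_{j=0}^m X_j^*P_jX_j\Big\|$$ holds for all $X_0,\dots,X_m\in\mathcal{A}$ if and only if $A_j^*A_j=P_j$ for all $j$ and $A_k^*A_j=0$ whenever $k\ne j$. In particular, if all $P_j$ are equal to a single projection $P$ and the equality holds for all $X_0,\dots,X_m\in\mathcal{A}$, then the $A_j$ are partial isometries with (mutually) orthogonal ranges and the same initial projection $P$.
   Context: Two elements $A,B$ of a C$^*$-algebra are said to have orthogonal ranges if $A^*B=0$. A projection is a self-adjoint idempotent; a partial isometry $V$ has initial projection $V^*V$. *)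

theory Defs
  imports "HOL-Analysis.Analysis"
begin

text \<open>
  C*-algebras as a type class. The class \<open>real_normed_algebra\<close> has no unit, so the algebra need
  not be unital, and the zero algebra is allowed.
\<close>

class cstar_algebra = real_normed_algebra + complete_space +
  fixes scaleC :: "complex \<Rightarrow> 'a \<Rightarrow> 'a" (infixr "*\<^sub>C" 75)
    and star :: "'a \<Rightarrow> 'a"
  assumes scaleC_add_right: "c *\<^sub>C (x + y) = c *\<^sub>C x + c *\<^sub>C y"
    and scaleC_add_left: "(c + d) *\<^sub>C x = c *\<^sub>C x + d *\<^sub>C x"
    and scaleC_scaleC: "c *\<^sub>C d *\<^sub>C x = (c * d) *\<^sub>C x"
    and scaleR_scaleC: "scaleR r x = complex_of_real r *\<^sub>C x"
    and mult_scaleC_left: "(c *\<^sub>C x) * y = c *\<^sub>C (x * y)"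
    and mult_scaleC_right: "x * (c *\<^sub>C y) = c *\<^sub>C (x * y)"
    and norm_scaleC: "norm (c *\<^sub>C x) = cmod c * norm x"
    and star_add: "star (x + y) = star x + star y"
    and star_scaleC: "star (c *\<^sub>C x) = cnj c *\<^sub>C star x"
    and star_mult: "star (x * y) = star y * star x"
    and star_star: "star (star x) = x"
    and cstar_identity: "norm (star x * x) = (norm x)\<^sup>2"

instantiation complex :: cstar_algebra
begin

definition scaleC_complex :: "complex \<Rightarrow> complex \<Rightarrow> complex" where
  "scaleC_complex c x = c * x"

definition star_complex :: "complex \<Rightarrow> complex" where
  "star_complex = cnj"

instance
  by standard
    (auto simp: scaleC_complex_def star_complex_def algebra_simps scaleR_conv_of_real
      norm_mult power2_eq_square)

end

text \<open>
  Spectra are taken in the unitization: the pair \<open>(c, x)\<close> stands for \<open>c 1 + x\<close>. A new unit is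
  adjoined even when the algebra is already unital; this only adds 0 to the spectrum, and so
  does not affect its being contained in the nonnegative reals.
\<close>

definition unitization_mult ::
    "complex \<times> 'a::cstar_algebra \<Rightarrow> complex \<times> 'a \<Rightarrow> complex \<times> 'a" where
  "unitization_mult u v =
    (fst u * fst v, fst u *\<^sub>C snd v + fst v *\<^sub>C snd u + snd u * snd v)"

definition unitization_invertible :: "complex \<times> 'a::cstar_algebra \<Rightarrow> bool" where
  "unitization_invertible u \<longleftrightarrow>
    (\<exists>v. unitization_mult u v = (1, 0) \<and> unitization_mult v u = (1, 0))"

definition spectrum :: "'a::cstar_algebra \<Rightarrow> complex set" where
  "spectrum a = {c. \<not> unitization_invertible (c, - a)}"

definition self_adjoint :: "'a::cstar_algebra \<Rightarrow> bool" where
  "self_adjoint a \<longleftrightarrow> star a = a"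

definition positive_element :: "'a::cstar_algebra \<Rightarrow> bool" where
  "positive_element a \<longleftrightarrow> self_adjoint a \<and> spectrum a \<subseteq> complex_of_real ` {0..}"

definition projection :: "'a::cstar_algebra \<Rightarrow> bool" where
  "projection p \<longleftrightarrow> self_adjoint p \<and> p * p = p"

definition partial_isometry :: "'a::cstar_algebra \<Rightarrow> bool" where
  "partial_isometry v \<longleftrightarrow> v * star v * v = v"

definition initial_projection :: "'a::cstar_algebra \<Rightarrow> 'a" where
  "initial_projection v = star v * v"

definition orthogonal_ranges :: "'a::cstar_algebra \<Rightarrow> 'a \<Rightarrow> bool" where
  "orthogonal_ranges a b \<longleftrightarrow> star a * b = 0"

end

theory Submission
  imports Defs
begin

text \<open>
  Write \<open>S = \<Sum> A\<^sub>j X\<^sub>j\<close> and \<open>D = \<Sum> X\<^sub>j\<^sup>* P\<^sub>j X\<^sub>j\<close>. Replacing each \<open>X\<^sub>j\<close> by \<open>X\<^sub>j z\<close> in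
  the norm equality shows \<open>\<parallel>z\<^sup>* S\<^sup>* S z\<parallel> = \<parallel>z\<^sup>* D z\<parallel>\<close> for all \<open>z\<close>. Positive elements with
  this property coincide, so \<open>S\<^sup>* S = D\<close> for every choice of the \<open>X\<^sub>j\<close>. Taking one \<open>X\<^sub>j\<close>
  nonzero gives \<open>A\<^sub>j\<^sup>* A\<^sub>j = P\<^sub>j\<close>, and polarising with two of them gives the orthogonality.
\<close>

subsection \<open>C*-algebra calculus\<close>

text \<open>The unitization is therefore made a C*-algebra, and positive elements are compared there
  by test elements from the ideal formed by the original algebra. This suffices because the compared
  elements lie in the ideal, and with them every product in which they occur. The same obstacle
  returns in the polarization: it yields \<open>star x * T * y = 0\<close> for all \<open>x\<close>
  and \<open>y\<close>, and \<open>T\<close> has to be recovered by choosing \<open>x\<close> and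
  \<open>y\<close> as products of \<open>T\<close> and \<open>star T\<close>.

  In place of functional calculus, positivity is expressed by a norm inequality, and positive
  elements get square roots from the binomial series. These roots commute with everything that
  commutes with the given element, which is what the algebraic identities below rely on.\<close>

instance cstar_algebra \<subseteq> banach ..

lemma scaleC_zero_right [simp]: "c *\<^sub>C (0::'a::cstar_algebra) = 0"
  using scaleC_add_right[of c 0 "0::'a"] by simp

lemma scaleC_zero_left [simp]: "0 *\<^sub>C (x::'a::cstar_algebra) = 0"
  using scaleC_add_left[of 0 0 x] by simp

lemma scaleC_one [simp]: "1 *\<^sub>C (x::'a::cstar_algebra) = x"
  using scaleR_scaleC[of 1 x] by simp

lemma scaleC_minus_right: "c *\<^sub>C (- x) = - (c *\<^sub>C (x::'a::cstar_algebra))"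
  using scaleC_add_right[of c x "- x"] by (simp add: eq_neg_iff_add_eq_0 add.commute)

lemma scaleC_minus_left: "(- c) *\<^sub>C x = - (c *\<^sub>C (x::'a::cstar_algebra))"
  using scaleC_add_left[of c "- c" x] by (simp add: eq_neg_iff_add_eq_0 add.commute)

lemma scaleC_diff_right: "c *\<^sub>C (x - y) = c *\<^sub>C x - c *\<^sub>C (y::'a::cstar_algebra)"
  using scaleC_add_right[of c x "- y"] by (simp add: scaleC_minus_right)

lemma scaleC_scaleR: "c *\<^sub>C (r *\<^sub>R x) = r *\<^sub>R (c *\<^sub>C (x::'a::cstar_algebra))"
  by (simp add: scaleR_scaleC scaleC_scaleC mult.commute)

lemma scaleR_scaleC_left: "(r *\<^sub>R c) *\<^sub>C x = r *\<^sub>R (c *\<^sub>C (x::'a::cstar_algebra))"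
  by (simp add: scaleR_scaleC[of r x] scaleR_scaleC[of r "c *\<^sub>C x"] scaleC_scaleC scaleR_conv_of_real)

lemma star_zero [simp]: "star (0::'a::cstar_algebra) = 0"
  using star_add[of 0 "0::'a"] by simp

lemma star_minus: "star (- x) = - star (x::'a::cstar_algebra)"
  using star_add[of x "- x"] by (simp add: eq_neg_iff_add_eq_0 add.commute)

lemma star_diff: "star (x - y) = star x - star (y::'a::cstar_algebra)"
  using star_add[of x "- y"] by (simp add: star_minus)

lemma star_scaleR: "star (r *\<^sub>R x) = r *\<^sub>R star (x::'a::cstar_algebra)"
  by (simp add: scaleR_scaleC star_scaleC)

lemma star_sum: "star (sum f S) = (\<Sum>i\<in>S. star (f i :: 'a::cstar_algebra))"
  by (induction S rule: infinite_finite_induct) (auto simp: star_add)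

lemma norm_star: "norm (star x) = norm (x::'a::cstar_algebra)"
proof -
  have *: "norm y \<le> norm (star y)" for y :: 'a
  proof (cases "y = 0")
    case False
    have "norm y * norm y \<le> norm (star y) * norm y"
      using cstar_identity[of y] norm_mult_ineq[of "star y" y] by (simp add: power2_eq_square)
    with False show ?thesis by simp
  qed simp
  show ?thesis using *[of x] *[of "star x"] by (simp add: star_star)
qed

lemma bounded_linear_star: "bounded_linear (star :: 'a::cstar_algebra \<Rightarrow> 'a)"
  by (rule bounded_linear_intro[where K=1]) (auto simp: star_add star_scaleR norm_star)

section \<open>The unitization as a C*-algebra\<close>

datatype 'a unitization = Unitization (scalar_part: complex) (alg_part: 'a)

lemma unitization_eq_iff:
  "u = v \<longleftrightarrow> scalar_part u = scalar_part v \<and> alg_part u = alg_part v"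
  by (auto intro: unitization.expand)

text \<open>Left multiplication by \<open>c 1 + x\<close> on the ideal. Its operator norm is the
  source of the C*-norm below; pairs already carry the Euclidean product norm, which in general is
  not a C*-norm, hence the separate type.\<close>

definition unitization_action :: "'a::cstar_algebra unitization \<Rightarrow> 'a \<Rightarrow> 'a" where
  "unitization_action u w = scalar_part u *\<^sub>C w + alg_part u * w"

lemma bounded_linear_unitization_action: "bounded_linear (unitization_action u)"
proof (rule bounded_linear_intro)
  fix w
  have "norm (unitization_action u w) \<le> norm (scalar_part u *\<^sub>C w) + norm (alg_part u * w)"
    unfolding unitization_action_def by (rule norm_triangle_ineq)
  also have "\<dots> \<le> norm w * (cmod (scalar_part u) + norm (alg_part u))"
    using norm_mult_ineq[of "alg_part u" w] by (simp add: norm_scaleC algebra_simps)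
  finally show "norm (unitization_action u w) \<le> norm w * (cmod (scalar_part u) + norm (alg_part u))" .
qed (auto simp: unitization_action_def scaleC_add_right scaleC_scaleR algebra_simps)

instantiation unitization :: (cstar_algebra) real_algebra_1
begin

definition zero_unitization :: "'a unitization" where "0 = Unitization 0 0"
definition one_unitization :: "'a unitization" where "1 = Unitization 1 0"
definition plus_unitization :: "'a unitization \<Rightarrow> 'a unitization \<Rightarrow> 'a unitization" where
  "u + v = Unitization (scalar_part u + scalar_part v) (alg_part u + alg_part v)"
definition minus_unitization :: "'a unitization \<Rightarrow> 'a unitization \<Rightarrow> 'a unitization" where
  "u - v = Unitization (scalar_part u - scalar_part v) (alg_part u - alg_part v)"
definition uminus_unitization :: "'a unitization \<Rightarrow> 'a unitization" where
  "- u = Unitization (- scalar_part u) (- alg_part u)"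
definition times_unitization :: "'a unitization \<Rightarrow> 'a unitization \<Rightarrow> 'a unitization" where
  "u * v = Unitization (scalar_part u * scalar_part v)
    (scalar_part u *\<^sub>C alg_part v + scalar_part v *\<^sub>C alg_part u + alg_part u * alg_part v)"
definition scaleR_unitization :: "real \<Rightarrow> 'a unitization \<Rightarrow> 'a unitization" where
  "r *\<^sub>R u = Unitization (r *\<^sub>R scalar_part u) (r *\<^sub>R alg_part u)"

lemmas unitization_ops = zero_unitization_def one_unitization_def plus_unitization_def
  minus_unitization_def uminus_unitization_def times_unitization_def scaleR_unitization_def

instance
  by standard (auto simp: unitization_ops unitization_eq_iff scaleC_add_left scaleC_add_right
      scaleC_scaleC scaleC_scaleR mult_scaleC_left mult_scaleC_right scaleR_scaleC_left
      algebra_simps)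

end

text \<open>
  The maximum is needed: if the algebra already has a unit \<open>e\<close>, then \<open>1 - e\<close> acts on it as zero.
\<close>

instantiation unitization :: (cstar_algebra) real_normed_algebra_1
begin

definition norm_unitization :: "'a unitization \<Rightarrow> real" where
  "norm u = max (cmod (scalar_part u)) (onorm (unitization_action u))"
definition sgn_unitization :: "'a unitization \<Rightarrow> 'a unitization" where
  "sgn (u :: 'a unitization) = scaleR (inverse (norm u)) u"
definition dist_unitization :: "'a unitization \<Rightarrow> 'a unitization \<Rightarrow> real" where
  "dist (u :: 'a unitization) v = norm (u - v)"
definition uniformity_unitization :: "('a unitization \<times> 'a unitization) filter" where
  "uniformity = (INF e\<in>{0<..}. principal {(x :: 'a unitization, y). dist x y < e})"
definition open_unitization :: "'a unitization set \<Rightarrow> bool" where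
  "open (U :: 'a unitization set) = (\<forall>x\<in>U. eventually (\<lambda>(x', y). x' = x \<longrightarrow> y \<in> U) uniformity)"

lemma scalar_part_le_norm: "cmod (scalar_part u) \<le> norm u" for u :: "'a unitization"
  by (simp add: norm_unitization_def)

lemma norm_unitization_action:
  "norm (unitization_action u w) \<le> norm u * norm w" for u :: "'a unitization"
  by (rule order_trans[OF onorm[OF bounded_linear_unitization_action]])
    (simp add: norm_unitization_def mult_right_mono)

lemma norm_unitization_le:
  fixes u :: "'a unitization"
  assumes "cmod (scalar_part u) \<le> K" "\<And>w. norm (unitization_action u w) \<le> K * norm w"
  shows "norm u \<le> K"
  using assms(1) order_trans[OF norm_ge_zero assms(1)] onorm_bound[OF _ assms(2)]
  by (simp add: norm_unitization_def)

lemma unitization_action_mult: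
  "unitization_action (u * v) w = unitization_action u (unitization_action v w)"
  by (simp add: unitization_action_def unitization_ops scaleC_add_right scaleC_scaleC
      mult_scaleC_left mult_scaleC_right algebra_simps)

lemma unitization_action_add:
  "unitization_action (u + v) w = unitization_action u w + unitization_action v w"
  by (simp add: unitization_action_def unitization_ops scaleC_add_left algebra_simps)

lemma unitization_action_scaleR:
  "unitization_action (r *\<^sub>R u) w = r *\<^sub>R unitization_action u w"
  by (simp add: unitization_action_def unitization_ops scaleR_scaleC_left scaleR_add_right)

lemma unitization_action_scaleC:
  "c *\<^sub>C unitization_action u w = unitization_action (Unitization (c * scalar_part u) (c *\<^sub>C alg_part u)) w"
  by (simp add: unitization_action_def scaleC_add_right scaleC_scaleC mult_scaleC_left)

text \<open>Acting on \<open>star x\<close>, where \<open>x\<close> is the algebra part, recovers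
  the norm of \<open>x\<close> through the C*-identity; the factor 2 pays for subtracting the scalar
  part. The bound makes the norm definite and lets completeness be inherited from the two
  components.\<close>

lemma alg_part_le_norm: "norm (alg_part u) \<le> 2 * norm u" for u :: "'a unitization"
proof (cases "alg_part u = 0")
  case False
  let ?x = "alg_part u" let ?w = "star ?x"
  have "norm ?x * norm ?x = norm (?x * ?w)"
    using cstar_identity[of ?w] by (simp add: star_star norm_star power2_eq_square)
  also have "?x * ?w = unitization_action u ?w - scalar_part u *\<^sub>C ?w"
    by (simp add: unitization_action_def)
  also have "norm \<dots> \<le> norm (unitization_action u ?w) + norm (scalar_part u *\<^sub>C ?w)"
    by (rule norm_triangle_ineq4)
  also have "\<dots> \<le> norm u * norm ?w + norm u * norm ?w"
    using norm_unitization_action[of u ?w]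
    by (intro add_mono) (auto simp: norm_scaleC scalar_part_le_norm mult_right_mono)
  finally have "norm ?x * norm ?x \<le> (2 * norm u) * norm ?x" by (simp add: norm_star)
  with False show ?thesis by simp
qed (use order_trans[OF norm_ge_zero scalar_part_le_norm[of u]] in simp)

instance
proof
  fix u v :: "'a unitization" and r :: real
  show "norm (u + v) \<le> norm u + norm v"
  proof (rule norm_unitization_le)
    show "cmod (scalar_part (u + v)) \<le> norm u + norm v"
      using norm_triangle_ineq[of "scalar_part u" "scalar_part v"]
        scalar_part_le_norm[of u] scalar_part_le_norm[of v] by (simp add: unitization_ops)
  next
    fix w
    show "norm (unitization_action (u + v) w) \<le> (norm u + norm v) * norm w"
      using norm_triangle_ineq[of "unitization_action u w" "unitization_action v w"]
        norm_unitization_action[of u w] norm_unitization_action[of v w]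
      by (simp add: unitization_action_add algebra_simps)
  qed
  show "norm (u * v) \<le> norm u * norm v"
  proof (rule norm_unitization_le)
    show "cmod (scalar_part (u * v)) \<le> norm u * norm v"
      using scalar_part_le_norm[of u] scalar_part_le_norm[of v]
      by (simp add: unitization_ops norm_mult mult_mono')
  next
    fix w
    have "norm (unitization_action (u * v) w) \<le> norm u * norm (unitization_action v w)"
      by (simp add: unitization_action_mult norm_unitization_action)
    also have "\<dots> \<le> norm u * (norm v * norm w)"
      using scalar_part_le_norm[of u] norm_ge_zero[of "scalar_part u"]
      by (intro mult_left_mono norm_unitization_action) linarith
    finally show "norm (unitization_action (u * v) w) \<le> norm u * norm v * norm w"
      by (simp add: mult.assoc)
  qed
  show "norm (r *\<^sub>R u) = \<bar>r\<bar> * norm u"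
  proof -
    have "unitization_action (r *\<^sub>R u) = (\<lambda>w. r *\<^sub>R unitization_action u w)"
      by (simp add: fun_eq_iff unitization_action_scaleR)
    then have "onorm (unitization_action (r *\<^sub>R u)) = \<bar>r\<bar> * onorm (unitization_action u)"
      using onorm_scaleR[OF bounded_linear_unitization_action] by simp
    then show ?thesis
      by (simp add: norm_unitization_def scaleR_unitization_def max_mult_distrib_left)
  qed
  show "norm u = 0 \<longleftrightarrow> u = 0"
  proof
    assume "norm u = 0"
    then show "u = 0"
      using scalar_part_le_norm[of u] alg_part_le_norm[of u]
      by (simp add: unitization_eq_iff zero_unitization_def)
  next
    assume "u = 0"
    then have "unitization_action u = (\<lambda>w. 0)"
      by (simp add: fun_eq_iff unitization_action_def zero_unitization_def)
    with \<open>u = 0\<close> show "norm u = 0"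
      by (simp add: norm_unitization_def zero_unitization_def onorm_zero)
  qed
  have "norm (1 :: 'a unitization) \<le> 1"
    by (rule norm_unitization_le) (simp_all add: one_unitization_def unitization_action_def)
  then show "norm (1 :: 'a unitization) = 1"
    using scalar_part_le_norm[of "1 :: 'a unitization"] by (simp add: one_unitization_def)
qed (auto simp: sgn_unitization_def dist_unitization_def uniformity_unitization_def
    open_unitization_def)

end

instantiation unitization :: (cstar_algebra) cstar_algebra
begin

definition scaleC_unitization :: "complex \<Rightarrow> 'a unitization \<Rightarrow> 'a unitization" where
  "c *\<^sub>C u = Unitization (c * scalar_part u) (c *\<^sub>C alg_part u)"
definition star_unitization :: "'a unitization \<Rightarrow> 'a unitization" where
  "star u = Unitization (cnj (scalar_part u)) (star (alg_part u))"

lemma unitization_action_star: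
  "star v * unitization_action u w = star (unitization_action (star u) v) * w"
  by (simp add: unitization_action_def star_unitization_def star_add star_scaleC star_mult
      star_star mult_scaleC_left mult_scaleC_right algebra_simps)

lemma norm_unitization_le_add:
  "norm u \<le> cmod (scalar_part u) + norm (alg_part u)" for u :: "'a unitization"
proof (rule norm_unitization_le)
  fix w
  show "norm (unitization_action u w) \<le> (cmod (scalar_part u) + norm (alg_part u)) * norm w"
    using norm_triangle_ineq[of "scalar_part u *\<^sub>C w" "alg_part u * w"]
      norm_mult_ineq[of "alg_part u" w]
    by (simp add: unitization_action_def norm_scaleC algebra_simps)
qed simp

text \<open>The C*-identity of the ideal, applied to the element
  \<open>unitization_action u w\<close>, turns a bound on the action of \<open>star u * u\<close>
  into one on the action of \<open>u\<close>. The scalar parts satisfy the identity by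
  themselves.\<close>

lemma norm_unitization_square_le:
  "(norm u)\<^sup>2 \<le> norm (star u * u)" for u :: "'a unitization"
proof -
  let ?K = "norm (star u * u)"
  have "norm u \<le> sqrt ?K"
  proof (rule norm_unitization_le)
    have "(cmod (scalar_part u))\<^sup>2 = cmod (scalar_part (star u * u))"
      by (simp add: star_unitization_def times_unitization_def norm_mult power2_eq_square)
    also have "\<dots> \<le> ?K" by (rule scalar_part_le_norm)
    finally show "cmod (scalar_part u) \<le> sqrt ?K" by (rule real_le_rsqrt)
  next
    fix w
    have "(norm (unitization_action u w))\<^sup>2
        = norm (star w * unitization_action (star u) (unitization_action u w))"
      using unitization_action_star[of w "star u" "unitization_action u w"]
      by (simp add: cstar_identity star_unitization_def star_star)
    also have "\<dots> \<le> norm w * norm (unitization_action (star u * u) w)"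
      using norm_mult_ineq[of "star w"] by (simp add: unitization_action_mult norm_star)
    also have "\<dots> \<le> norm w * (?K * norm w)"
      by (intro mult_left_mono norm_unitization_action) simp
    also have "\<dots> = (sqrt ?K * norm w)\<^sup>2" by (simp add: power_mult_distrib power2_eq_square)
    finally show "norm (unitization_action u w) \<le> sqrt ?K * norm w"
      by (rule power2_le_imp_le) simp
  qed
  then show ?thesis using power_mono[of "norm u" "sqrt ?K" 2] by simp
qed

instance
proof
  fix X :: "nat \<Rightarrow> 'a unitization"
  assume X: "Cauchy X"
  have 1: "dist (scalar_part u) (scalar_part v) \<le> dist u v" for u v :: "'a unitization"
    using scalar_part_le_norm[of "u - v"] by (simp add: dist_norm minus_unitization_def)
  have 2: "dist (alg_part u) (alg_part v) \<le> 2 * dist u v" for u v :: "'a unitization"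
    using alg_part_le_norm[of "u - v"] by (simp add: dist_norm minus_unitization_def)
  have "Cauchy (\<lambda>n. scalar_part (X n))"
    unfolding Cauchy_def using X[unfolded Cauchy_def] 1 by (meson le_less_trans)
  then obtain c where c: "(\<lambda>n. scalar_part (X n)) \<longlonglongrightarrow> c"
    using Cauchy_convergent_iff convergent_def by blast
  have "Cauchy (\<lambda>n. alg_part (X n))"
    unfolding Cauchy_def
  proof (intro allI impI)
    fix e :: real assume "e > 0"
    then obtain M where "\<And>m n. m \<ge> M \<Longrightarrow> n \<ge> M \<Longrightarrow> dist (X m) (X n) < e / 2"
      using X[unfolded Cauchy_def] by (meson half_gt_zero)
    then show "\<exists>M. \<forall>m\<ge>M. \<forall>n\<ge>M. dist (alg_part (X m)) (alg_part (X n)) < e"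
      using 2 by (intro exI[of _ M]) (smt (verit) field_sum_of_halves)
  qed
  then obtain a where a: "(\<lambda>n. alg_part (X n)) \<longlonglongrightarrow> a"
    using Cauchy_convergent_iff convergent_def by blast
  have "(\<lambda>n. cmod (scalar_part (X n) - c) + norm (alg_part (X n) - a)) \<longlonglongrightarrow> 0"
    using tendsto_add[OF tendsto_norm_zero[OF LIM_zero[OF c]] tendsto_norm_zero[OF LIM_zero[OF a]]]
    by simp
  then have "(\<lambda>n. X n - Unitization c a) \<longlonglongrightarrow> 0"
  proof (rule Lim_null_comparison[rotated])
    show "\<forall>\<^sub>F n in sequentially. norm (X n - Unitization c a)
        \<le> cmod (scalar_part (X n) - c) + norm (alg_part (X n) - a)"
      using norm_unitization_le_add[of "X n - Unitization c a" for n]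
      by (intro always_eventually) (simp add: minus_unitization_def)
  qed
  then show "convergent X" using LIM_zero_iff convergent_def by blast
next
  fix u v :: "'a unitization" and c d :: complex and r :: real
  show "norm (c *\<^sub>C u) = cmod c * norm u"
  proof -
    have le: "norm (c *\<^sub>C u) \<le> cmod c * norm u" for c and u :: "'a unitization"
    proof (rule norm_unitization_le)
      show "cmod (scalar_part (c *\<^sub>C u)) \<le> cmod c * norm u"
        by (simp add: scaleC_unitization_def norm_mult mult_left_mono scalar_part_le_norm)
    next
      fix w
      have "unitization_action (c *\<^sub>C u) w = c *\<^sub>C unitization_action u w"
        by (simp add: unitization_action_scaleC scaleC_unitization_def)
      then show "norm (unitization_action (c *\<^sub>C u) w) \<le> cmod c * norm u * norm w"
        using norm_unitization_action[of u w]
        by (simp add: norm_scaleC mult.assoc mult_left_mono)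
    qed
    show ?thesis
    proof (cases "c = 0")
      case True
      then show ?thesis using le[of 0 u] by simp
    next
      case False
      then have "u = (1 / c) *\<^sub>C c *\<^sub>C u"
        by (simp add: scaleC_unitization_def scaleC_scaleC unitization_eq_iff)
      then have "norm u \<le> cmod (1 / c) * norm (c *\<^sub>C u)" by (metis le)
      with False have "cmod c * norm u \<le> norm (c *\<^sub>C u)"
        by (simp add: norm_divide field_simps)
      with le[of c u] show ?thesis by simp
    qed
  qed
  have le: "norm u \<le> norm (star u)" for u :: "'a unitization"
  proof (cases "u = 0")
    case False
    have "norm u * norm u \<le> norm (star u) * norm u"
      using norm_unitization_square_le[of u] norm_mult_ineq[of "star u" u]
      by (simp add: power2_eq_square)
    with False show ?thesis by simp
  qed simp
  have ss: "star (star u) = u" for u :: "'a unitization"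
    by (simp add: star_unitization_def star_star)
  show "norm (star u * u) = (norm u)\<^sup>2"
  proof (rule antisym)
    have "norm (star u * u) \<le> norm (star u) * norm u" by (rule norm_mult_ineq)
    also have "norm (star u) = norm u"
      using le[of u] le[of "star u"] by (simp add: ss)
    finally show "norm (star u * u) \<le> (norm u)\<^sup>2" by (simp add: power2_eq_square)
  qed (rule norm_unitization_square_le)
qed (auto simp: scaleC_unitization_def star_unitization_def unitization_ops unitization_eq_iff
    scaleC_add_left scaleC_add_right scaleC_scaleC scaleR_scaleC[where 'a='a] scaleR_conv_of_real
    mult_scaleC_left mult_scaleC_right star_add star_scaleC star_mult star_star algebra_simps)

end

class unital_cstar_algebra = cstar_algebra + real_normed_algebra_1

instance unitization :: (cstar_algebra) unital_cstar_algebra ..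

subsection \<open>Positivity in unital C*-algebras\<close>

lemma star_one [simp]: "star (1::'a::unital_cstar_algebra) = 1"
proof -
  have "star (star (1::'a) * 1) = star 1 * 1" by (simp only: star_mult star_star)
  then show ?thesis by (simp add: star_star)
qed

lemma star_power: "star (x ^ n) = star (x::'a::unital_cstar_algebra) ^ n"
  by (induction n) (simp_all add: star_mult power_commutes)

lemma self_adjoint_one [simp]: "self_adjoint (1::'a::unital_cstar_algebra)"
  by (simp add: self_adjoint_def)

lemma self_adjoint_add: "self_adjoint x \<Longrightarrow> self_adjoint y \<Longrightarrow> self_adjoint (x + y)"
  by (simp add: self_adjoint_def star_add)

lemma self_adjoint_diff: "self_adjoint x \<Longrightarrow> self_adjoint y \<Longrightarrow> self_adjoint (x - y)"
  by (simp add: self_adjoint_def star_diff)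

lemma self_adjoint_minus: "self_adjoint x \<Longrightarrow> self_adjoint (- x)"
  by (simp add: self_adjoint_def star_minus)

lemma self_adjoint_scaleR: "self_adjoint x \<Longrightarrow> self_adjoint (r *\<^sub>R x)"
  by (simp add: self_adjoint_def star_scaleR)

lemma self_adjoint_power: "self_adjoint x \<Longrightarrow> self_adjoint (x ^ n)"
  for x :: "'a::unital_cstar_algebra"
  by (simp add: self_adjoint_def star_power)

lemma self_adjoint_mult_commute:
  "self_adjoint x \<Longrightarrow> self_adjoint y \<Longrightarrow> x * y = y * x \<Longrightarrow> self_adjoint (x * y)"
  by (simp add: self_adjoint_def star_mult)

lemma self_adjoint_star_mult: "self_adjoint (star x * x)"
  by (simp add: self_adjoint_def star_mult star_star)

lemma norm_self_adjoint_square: "self_adjoint x \<Longrightarrow> norm (x * x) = (norm x)\<^sup>2"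
  using cstar_identity[of x] by (simp add: self_adjoint_def)

lemma norm_self_adjoint_power_two:
  fixes x :: "'a::unital_cstar_algebra"
  assumes "self_adjoint x"
  shows "norm (x ^ 2 ^ n) = norm x ^ 2 ^ n"
proof (induction n)
  case (Suc n)
  have "x ^ 2 ^ Suc n = x ^ 2 ^ n * x ^ 2 ^ n" by (simp add: mult_2 flip: power_add)
  then show ?case
    using norm_self_adjoint_square[OF self_adjoint_power[OF assms, of "2 ^ n"]] Suc
    by (simp add: power_mult[symmetric] mult.commute)
qed simp

text \<open>For \<open>u = h + i k\<close> commutation gives
  \<open>star u * u = h * h + k * k\<close>, and the real part \<open>h\<close> of \<open>u\<close>
  has norm at most \<open>norm u\<close>.\<close>

lemma norm_square_le_norm_sum_squares:
  assumes h: "self_adjoint h" and k: "self_adjoint k" and hk: "h * k = k * h"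
  shows "(norm h)\<^sup>2 \<le> norm (h * h + k * k)"
proof -
  let ?u = "h + \<i> *\<^sub>C k"
  have su: "star ?u = h - \<i> *\<^sub>C k"
    using h k by (simp add: self_adjoint_def star_add star_scaleC scaleC_minus_left)
  have "star ?u * ?u = h * h + k * k"
    unfolding su
    by (simp add: algebra_simps mult_scaleC_left mult_scaleC_right scaleC_scaleC hk
        scaleC_minus_left scaleC_add_right scaleC_diff_right)
  then have *: "(norm ?u)\<^sup>2 = norm (h * h + k * k)" using cstar_identity[of ?u] by simp
  have "2 *\<^sub>R h = ?u + star ?u" unfolding su by (simp add: scaleR_2)
  then have "2 * norm h \<le> norm ?u + norm (star ?u)"
    using norm_triangle_ineq[of ?u "star ?u"] by (metis abs_numeral norm_scaleR)
  then have "norm h \<le> norm ?u" by (simp add: norm_star)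
  with * show ?thesis using power_mono[of "norm h" "norm ?u" 2] by simp
qed

section \<open>Square roots from the binomial series\<close>

lemma sqrt_one_minus_coefficients:
  defines "b \<equiv> \<lambda>k. (1/2 gchoose k) * (-1) ^ k :: real"
  shows "b 0 = 1" "summable (\<lambda>k. \<bar>b k\<bar>)" "(\<Sum>k. \<bar>b (Suc k)\<bar>) \<le> 1"
    "(\<Sum>i\<le>k. b i * b (k - i)) = (if k = 0 then 1 else if k = 1 then - 1 else 0)"
proof -
  show b0: "b 0 = 1" by (simp add: b_def)
  have neg: "b (Suc k) \<le> 0" for k
  proof -
    have "b (Suc k) = - (1/2) * pochhammer (1/2) k / fact (Suc k)"
      unfolding b_def gbinomial_pochhammer
      by (simp add: pochhammer_rec flip: power_mult_distrib del: fact_Suc)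
    also have "\<dots> \<le> 0"
      by (intro divide_nonpos_pos mult_nonpos_nonneg pochhammer_nonneg) auto
    finally show ?thesis .
  qed
  \<comment> \<open>The partial sums of \<open>b\<close> collapse to a single coefficient, which is
    nonnegative. As \<open>b 0 = 1\<close> and all later terms are at most 0, the absolute values of
    the latter add up to at most 1.\<close>
  have part: "(\<Sum>k<n. \<bar>b (Suc k)\<bar>) \<le> 1" for n
  proof -
    have "(\<Sum>k\<le>n. b k) = (- 1) ^ n * (- (1/2) gchoose n)"
      using gbinomial_sum_lower_neg[of "1/2 :: real" n] by (simp add: b_def)
    also have "\<dots> = pochhammer (1/2) n / fact n"
      by (simp add: gbinomial_pochhammer flip: power_mult_distrib)
    also have "\<dots> \<ge> 0" by (intro divide_nonneg_nonneg pochhammer_nonneg) auto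
    finally have "(\<Sum>k\<le>n. b k) \<ge> 0" .
    moreover have "(\<Sum>k\<le>n. b k) = 1 + (\<Sum>k<n. b (Suc k))"
      using sum.atMost_shift[of b n] b0 by simp
    moreover have "(\<Sum>k<n. \<bar>b (Suc k)\<bar>) = - (\<Sum>k<n. b (Suc k))"
      using neg by (simp add: sum_negf[symmetric] abs_of_nonpos)
    ultimately show ?thesis by simp
  qed
  have summ: "summable (\<lambda>k. \<bar>b (Suc k)\<bar>)"
    by (rule summableI_nonneg_bounded[where x=1]) (use part in auto)
  then show "summable (\<lambda>k. \<bar>b k\<bar>)" using summable_Suc_iff[of "\<lambda>k. \<bar>b k\<bar>"] by simp
  show "(\<Sum>k. \<bar>b (Suc k)\<bar>) \<le> 1" by (rule suminf_le_const[OF summ part])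
  \<comment> \<open>Vandermonde's identity for 1/2 + 1/2 leaves the coefficients of
    \<open>1 - x\<close>.\<close>
  have "(\<Sum>i\<le>k. b i * b (k - i)) = (\<Sum>i\<le>k. (-1) ^ k * ((1/2 gchoose i) * (1/2 gchoose (k - i))))"
    by (intro sum.cong refl) (simp add: b_def flip: power_add)
  also have "\<dots> = (-1) ^ k * (\<Sum>i=0..k. (1/2 gchoose i) * (1/2 gchoose (k - i)))"
    by (simp add: sum_distrib_left atMost_atLeast0)
  also have "\<dots> = (-1) ^ k * (1 gchoose k)" by (simp add: gbinomial_Vandermonde)
  also have "(1 gchoose k) = real (1 choose k)" by (simp add: binomial_gbinomial)
  finally have "(\<Sum>i\<le>k. b i * b (k - i)) = (-1) ^ k * real (1 choose k)" .
  moreover consider "k = 0" | "k = 1" | "k > 1" by linarith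
  ultimately show "(\<Sum>i\<le>k. b i * b (k - i)) = (if k = 0 then 1 else if k = 1 then - 1 else 0)"
    by cases (simp_all add: binomial_eq_0)
qed

lemma self_adjoint_suminf:
  assumes "summable f" "\<And>k. self_adjoint (f k :: 'a::cstar_algebra)"
  shows "self_adjoint (suminf f)"
  using bounded_linear.suminf[OF bounded_linear_star assms(1)] assms(2)
  by (simp add: self_adjoint_def)

text \<open>Absolute summability of the coefficients makes the series converge on the whole closed
  unit ball. The bound on \<open>1 - s\<close> will make the root itself positive, and the
  commutation property passes to the limit from the powers of \<open>y\<close>.\<close>

lemma sqrt_one_minus:
  fixes y :: "'a::unital_cstar_algebra"
  assumes y: "self_adjoint y" "norm y \<le> 1"
  obtains s where "self_adjoint s" "s * s = 1 - y" "norm (1 - s) \<le> 1"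
    "\<forall>z. z * y = y * z \<longrightarrow> z * s = s * z"
proof
  define b :: "nat \<Rightarrow> real" where "b k = (1/2 gchoose k) * (-1) ^ k" for k
  note coeff = sqrt_one_minus_coefficients[folded b_def]
  define f where "f k = b k *\<^sub>R y ^ k" for k
  define s where "s = suminf f"
  have le: "norm (f k) \<le> \<bar>b k\<bar>" for k
  proof -
    have "norm (y ^ k) \<le> 1"
      using norm_power_ineq[of y k] power_le_one[of "norm y" k] y(2) by simp
    then show ?thesis by (simp add: f_def mult_left_le)
  qed
  have ns: "summable (\<lambda>k. norm (f k))"
    by (rule summable_comparison_test'[OF coeff(2)]) (simp add: le)
  then have sf: "summable f" by (rule summable_norm_cancel)
  show "self_adjoint s" unfolding s_def
    by (rule self_adjoint_suminf[OF sf]) (simp add: f_def self_adjoint_scaleR self_adjoint_power y)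
  show "s * s = 1 - y"
  proof -
    have "(\<Sum>i\<le>k. f i * f (k - i)) = (if k = 0 then 1 else if k = 1 then - y else 0)" for k
    proof -
      have "(\<Sum>i\<le>k. f i * f (k - i)) = (\<Sum>i\<le>k. b i * b (k - i)) *\<^sub>R y ^ k"
        unfolding scaleR_sum_left
        by (intro sum.cong refl) (simp add: f_def flip: power_add)
      also have "\<dots> = (if k = 0 then 1 else if k = 1 then - y else 0)"
        unfolding coeff(4) by simp
      finally show ?thesis .
    qed
    then have "(\<lambda>k. if k = 0 then 1 else if k = 1 then - y else 0) sums (s * s)"
      using Cauchy_product_sums[OF ns ns] by (simp only: s_def)
    moreover have "(\<lambda>k. if k = 0 then 1 else if k = 1 then - y else 0) sums
        (\<Sum>k\<in>{0,1::nat}. if k = 0 then 1 else if k = 1 then - y else 0)"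
      by (rule sums_finite) auto
    ultimately have "s * s = (\<Sum>k\<in>{0,1::nat}. if k = 0 then 1 else if k = 1 then - y else 0)"
      by (rule sums_unique2)
    then show ?thesis by simp
  qed
  show "norm (1 - s) \<le> 1"
  proof -
    have ns': "summable (\<lambda>k. norm (f (Suc k)))"
      using ns summable_Suc_iff[of "\<lambda>k. norm (f k)"] by simp
    have "s - 1 = (\<Sum>k. f (Suc k))"
      using suminf_split_head[OF sf] by (simp add: s_def f_def coeff(1))
    then have "norm (1 - s) \<le> (\<Sum>k. norm (f (Suc k)))"
      using summable_norm[OF ns'] by (simp only: norm_minus_commute[of 1 s])
    also have "\<dots> \<le> (\<Sum>k. \<bar>b (Suc k)\<bar>)"
      by (intro suminf_le le ns' iffD2[OF summable_Suc_iff[of "\<lambda>k. \<bar>b k\<bar>"] coeff(2)])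
    finally show ?thesis using coeff(3) by simp
  qed
  show "\<forall>z. z * y = y * z \<longrightarrow> z * s = s * z"
  proof (intro allI impI)
    fix z assume that: "z * y = y * z"
    have "z * f k = f k * z" for k
      using power_commuting_commutes[of y z k] that by (simp add: f_def)
    then have "(\<Sum>k. z * f k) = (\<Sum>k. f k * z)" by (rule suminf_cong)
    then show "z * s = s * z" unfolding s_def by (simp only: suminf_mult[OF sf] suminf_mult2[OF sf])
  qed
qed

text \<open>
  Positivity in terms of the norm; for self-adjoint elements this is equivalent to the spectrum
  being nonnegative, but sums and the norm order are easier to handle.
\<close>

definition nonneg :: "'a::unital_cstar_algebra \<Rightarrow> bool" where
  "nonneg y \<longleftrightarrow> self_adjoint y \<and> (\<exists>t\<ge>0. norm (t *\<^sub>R 1 - y) \<le> t)"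

lemma nonneg_self_adjoint: "nonneg y \<Longrightarrow> self_adjoint y"
  by (simp add: nonneg_def)

lemma nonnegI: "self_adjoint y \<Longrightarrow> norm (t *\<^sub>R 1 - y) \<le> t \<Longrightarrow> nonneg y"
  unfolding nonneg_def by (intro conjI exI[of _ t]) (auto intro: order_trans[OF norm_ge_zero])

lemma nonneg_zero: "nonneg 0"
  by (rule nonnegI[of _ 0]) (auto simp: self_adjoint_def)

lemma nonneg_add:
  assumes "nonneg x" "nonneg y" shows "nonneg (x + y)"
proof -
  obtain s t where st: "norm (s *\<^sub>R 1 - x) \<le> s" "norm (t *\<^sub>R 1 - y) \<le> t"
    using assms by (auto simp: nonneg_def)
  have eq: "(s + t) *\<^sub>R 1 - (x + y) = (s *\<^sub>R 1 - x) + (t *\<^sub>R 1 - y)" by (simp add: algebra_simps)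
  have "norm ((s + t) *\<^sub>R 1 - (x + y)) \<le> s + t"
    unfolding eq using st by (rule norm_triangle_mono)
  then show ?thesis
    by (rule nonnegI[OF self_adjoint_add[OF assms[THEN nonneg_self_adjoint]]])
qed

lemma nonneg_scaleR:
  assumes "nonneg x" "r \<ge> 0" shows "nonneg (r *\<^sub>R x)"
proof -
  obtain s where s: "norm (s *\<^sub>R 1 - x) \<le> s" using assms by (auto simp: nonneg_def)
  have "norm ((r * s) *\<^sub>R 1 - r *\<^sub>R x) = r * norm (s *\<^sub>R 1 - x)"
    using norm_scaleR[of r "s *\<^sub>R 1 - x"] assms(2) by (simp add: scaleR_diff_right)
  then have "norm ((r * s) *\<^sub>R 1 - r *\<^sub>R x) \<le> r * s" using s assms(2) by (simp add: mult_left_mono)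
  then show ?thesis
    by (rule nonnegI[OF self_adjoint_scaleR[OF nonneg_self_adjoint[OF assms(1)]]])
qed

lemma nonneg_sum: "(\<And>i. i \<in> S \<Longrightarrow> nonneg (f i)) \<Longrightarrow> nonneg (sum f S)"
  by (induction S rule: infinite_finite_induct) (auto intro: nonneg_add nonneg_zero)

lemma nonneg_norm_minus:
  assumes "self_adjoint y" "norm y \<le> t" shows "nonneg (t *\<^sub>R 1 - y)"
  using assms by (intro nonnegI[of _ t] self_adjoint_diff self_adjoint_scaleR) simp_all

lemma nonneg_sqrt:
  fixes y :: "'a::unital_cstar_algebra"
  assumes "nonneg y"
  obtains s where "nonneg s" "s * s = y" "\<forall>z. z * y = y * z \<longrightarrow> z * s = s * z"
proof -
  obtain t where t: "norm (t *\<^sub>R 1 - y) \<le> t" "t \<ge> 0" and y: "self_adjoint y"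
    using assms by (auto simp: nonneg_def)
  show ?thesis
  proof (cases "t = 0")
    case True
    then have "y = 0" using t by simp
    then show ?thesis using that[of 0] nonneg_zero by simp
  next
    case False
    then have "t > 0" using t by simp
    \<comment> \<open>Dividing by \<open>t\<close> turns the norm condition on \<open>y\<close> into
      \<open>norm v \<le> 1\<close>, where \<open>y / t = 1 - v\<close>.\<close>
    let ?v = "1 - (1 / t) *\<^sub>R y"
    have v: "self_adjoint ?v" by (intro self_adjoint_diff self_adjoint_scaleR y self_adjoint_one)
    have "norm ?v = norm ((1 / t) *\<^sub>R (t *\<^sub>R 1 - y))" using \<open>t > 0\<close> by (simp add: scaleR_diff_right)
    also have "\<dots> = norm (t *\<^sub>R 1 - y) / t" unfolding norm_scaleR using \<open>t > 0\<close> by simp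
    also have "\<dots> \<le> 1" using t \<open>t > 0\<close> by simp
    finally obtain s where s: "self_adjoint s" "s * s = 1 - ?v" "norm (1 - s) \<le> 1"
      "\<forall>z. z * ?v = ?v * z \<longrightarrow> z * s = s * z"
      by (rule sqrt_one_minus[OF v])
    show ?thesis
    proof (rule that[of "sqrt t *\<^sub>R s"])
      show "nonneg (sqrt t *\<^sub>R s)"
        using s(1,3) t(2) by (intro nonneg_scaleR nonnegI[of _ 1]) simp_all
      show "(sqrt t *\<^sub>R s) * (sqrt t *\<^sub>R s) = y" using s(2) \<open>t > 0\<close> by simp
      have "z * (sqrt t *\<^sub>R s) = (sqrt t *\<^sub>R s) * z" if "z * y = y * z" for z
      proof -
        from that have "z * s = s * z" by (intro s(4)[rule_format]) (simp add: algebra_simps)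
        then show ?thesis by simp
      qed
      then show "\<forall>z. z * y = y * z \<longrightarrow> z * (sqrt t *\<^sub>R s) = (sqrt t *\<^sub>R s) * z" by blast
    qed
  qed
qed

text \<open>After scaling \<open>h\<close> to a \<open>g\<close> of norm 1, let \<open>k\<close> be
  the root of \<open>1 - g * g\<close>. It commutes with \<open>g\<close>, and
  \<open>k * k + g * g = 1\<close>, so \<open>norm (k * k) \<le> 1\<close>; this is the norm
  condition for \<open>g * g\<close> with constant 1.\<close>

lemma nonneg_square:
  fixes h :: "'a::unital_cstar_algebra"
  assumes h: "self_adjoint h" shows "nonneg (h * h)"
proof (cases "h = 0")
  case False
  let ?n = "norm h" let ?g = "(1 / norm h) *\<^sub>R h"
  have g: "self_adjoint ?g" by (rule self_adjoint_scaleR[OF h])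
  have gg: "self_adjoint (?g * ?g)" by (rule self_adjoint_mult_commute[OF g g refl])
  have "norm (?g * ?g) \<le> 1" using norm_self_adjoint_square[OF g] False by simp
  then obtain k where k: "self_adjoint k" "k * k = 1 - ?g * ?g" "norm (1 - k) \<le> 1"
      "\<forall>z. z * (?g * ?g) = (?g * ?g) * z \<longrightarrow> z * k = k * z"
    by (rule sqrt_one_minus[OF gg])
  have gk: "?g * k = k * ?g" by (intro k(4)[rule_format]) (simp only: mult.assoc)
  have "(norm k)\<^sup>2 \<le> norm (k * k + ?g * ?g)"
    by (rule norm_square_le_norm_sum_squares[OF k(1) g gk[symmetric]])
  then have "norm (1 - ?g * ?g) \<le> 1" using norm_self_adjoint_square[OF k(1)] k(2) by simp
  then have "nonneg (?g * ?g)" using gg by (intro nonnegI[of _ 1]) simp_all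
  then have "nonneg (?n\<^sup>2 *\<^sub>R (?g * ?g))" by (rule nonneg_scaleR) simp
  then show ?thesis using False by (simp add: power2_eq_square)
qed (simp add: nonneg_zero)

text \<open>The square roots \<open>p\<close> of \<open>x\<close> and \<open>q\<close> of
  \<open>t - x\<close> commute and their squares add up to \<open>t\<close>, so the norm of
  \<open>x = p * p\<close> is at most \<open>t\<close>.\<close>

lemma nonneg_norm_le:
  fixes x :: "'a::unital_cstar_algebra"
  assumes x: "nonneg x" and tx: "nonneg (t *\<^sub>R 1 - x)" and "t \<ge> 0"
  shows "norm x \<le> t"
proof -
  obtain p where p: "nonneg p" "p * p = x" "\<forall>z. z * x = x * z \<longrightarrow> z * p = p * z"
    by (rule nonneg_sqrt[OF x])
  obtain q where q: "nonneg q" "q * q = t *\<^sub>R 1 - x"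
      "\<forall>z. z * (t *\<^sub>R 1 - x) = (t *\<^sub>R 1 - x) * z \<longrightarrow> z * q = q * z"
    by (rule nonneg_sqrt[OF tx])
  have "p * x = x * p" by (simp add: mult.assoc flip: p(2))
  then have "p * q = q * p" by (intro q(3)[rule_format]) (simp add: algebra_simps)
  then have "(norm p)\<^sup>2 \<le> norm (p * p + q * q)"
    by (rule norm_square_le_norm_sum_squares[OF p(1)[THEN nonneg_self_adjoint] q(1)[THEN nonneg_self_adjoint]])
  then show ?thesis
    using p(2) q(2) norm_self_adjoint_square[OF nonneg_self_adjoint[OF p(1)]] \<open>t \<ge> 0\<close> by simp
qed

lemma nonneg_antisym:
  assumes "nonneg x" "nonneg (- x)" shows "x = 0"
  using nonneg_norm_le[of x 0] assms by simp

lemma nonneg_norm_mono: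
  assumes x: "nonneg x" and y: "nonneg y"
  shows "norm x \<le> norm (x + y)"
proof (rule nonneg_norm_le[OF x])
  have "nonneg ((norm (x + y) *\<^sub>R 1 - (x + y)) + y)"
    by (intro nonneg_add[OF nonneg_norm_minus y] nonneg_self_adjoint nonneg_add x y order_refl)
  then show "nonneg (norm (x + y) *\<^sub>R 1 - x)" by simp
qed simp

section \<open>Positivity and invertibility\<close>

lemma nonneg_invertible:
  fixes y :: "'a::unital_cstar_algebra"
  assumes "nonneg y" "e > 0"
  obtains b where "self_adjoint b" "b * (y + e *\<^sub>R 1) = 1" "(y + e *\<^sub>R 1) * b = 1"
proof -
  obtain t where t: "norm (t *\<^sub>R 1 - y) \<le> t" "t \<ge> 0" and y: "self_adjoint y"
    using assms by (auto simp: nonneg_def)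
  \<comment> \<open>Here \<open>y + e = (t + e) (1 - v)\<close> and
    \<open>norm v \<le> t / (t + e) < 1\<close>, so the Neumann series inverts
    \<open>1 - v\<close>.\<close>
  define v where "v = (1 / (t + e)) *\<^sub>R (t *\<^sub>R 1 - y)"
  have "norm v < 1" using t assms(2) by (simp add: v_def)
  then have sv: "summable (\<lambda>n. v ^ n)" by (rule complete_algebra_summable_geometric)
  define w where "w = (\<Sum>n. v ^ n)"
  have shift: "(\<Sum>n. v ^ Suc n) = w - 1" using suminf_split_head[OF sv] by (simp add: w_def)
  have vw: "v * w = w - 1" using suminf_mult[OF sv, of v] shift by (simp add: w_def)
  have wv: "w * v = w - 1"
    using suminf_mult2[OF sv, of v] shift by (simp add: w_def power_commutes)
  have "(t + e) *\<^sub>R v = t *\<^sub>R 1 - y" using t assms(2) by (simp add: v_def)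
  then have v1: "y + e *\<^sub>R 1 = (t + e) *\<^sub>R (1 - v)"
    by (simp only: scaleR_diff_right) (simp add: algebra_simps)
  have sa: "self_adjoint v" unfolding v_def
    by (intro self_adjoint_scaleR self_adjoint_diff y self_adjoint_one)
  show ?thesis
  proof (rule that[of "(1 / (t + e)) *\<^sub>R w"])
    show "self_adjoint ((1 / (t + e)) *\<^sub>R w)" unfolding w_def
      by (intro self_adjoint_scaleR self_adjoint_suminf sv self_adjoint_power sa)
    have "w * (1 - v) = 1" "(1 - v) * w = 1"
      by (simp_all only: right_diff_distrib left_diff_distrib vw wv) simp_all
    then show "(1 / (t + e)) *\<^sub>R w * (y + e *\<^sub>R 1) = 1" "(y + e *\<^sub>R 1) * (1 / (t + e)) *\<^sub>R w = 1"
      using t(2) assms(2) by (simp_all add: v1)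
  qed
qed

lemma power_square_self: "x ^ n * x ^ n = (x * x) ^ n" for x :: "'a::monoid_mult"
  using power_even_eq[of x n] by (simp add: power_mult flip: power2_eq_square)

lemma one_minus_mult_geometric_sum: "(1 - y) * (\<Sum>k<n. y ^ k) = 1 - y ^ n" for y :: "'a::ring_1"
  by (induction n) (simp_all add: distrib_left left_diff_distrib[of _ _ "y ^ _"])

text \<open>The difference is the square of the self-adjoint element \<open>x ^ k * s\<close>, where
  \<open>s\<close> is a root of \<open>1 - (x * x) ^ (n - k)\<close> that commutes with
  \<open>x\<close>.\<close>

lemma nonneg_power_diff:
  fixes x :: "'a::unital_cstar_algebra"
  assumes x: "self_adjoint x" "norm x \<le> 1" and "k \<le> n"
  shows "nonneg ((x * x) ^ k - (x * x) ^ n)"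
proof -
  let ?z = "(x * x) ^ (n - k)"
  have xx: "self_adjoint (x * x)" "norm (x * x) \<le> 1"
    using x by (auto simp: norm_self_adjoint_square power_le_one intro: self_adjoint_mult_commute)
  have "norm ?z \<le> 1"
    using norm_power_ineq[of "x * x" "n - k"] power_le_one[of "norm (x * x)" "n - k"] xx by simp
  then obtain s where s: "self_adjoint s" "s * s = 1 - ?z" "norm (1 - s) \<le> 1"
      "\<forall>w. w * ?z = ?z * w \<longrightarrow> w * s = s * w"
    by (rule sqrt_one_minus[OF self_adjoint_power[OF xx(1)]])
  have "x * s = s * x"
    using power_commuting_commutes[of "x * x" x "n - k"] by (intro s(4)[rule_format]) (simp add: mult.assoc)
  then have c: "x ^ k * s = s * x ^ k" by (simp add: power_commuting_commutes)
  have "x ^ k * s * (x ^ k * s) = x ^ k * x ^ k * (s * s)" by (metis c mult.assoc)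
  also have "x ^ k * x ^ k = (x * x) ^ k" by (rule power_square_self)
  also have "(x * x) ^ k * (s * s) = (x * x) ^ k - (x * x) ^ n"
    using \<open>k \<le> n\<close> by (simp add: s(2) right_diff_distrib flip: power_add)
  finally have "x ^ k * s * (x ^ k * s) = (x * x) ^ k - (x * x) ^ n" .
  moreover have "self_adjoint (x ^ k * s)"
    by (intro self_adjoint_mult_commute self_adjoint_power x s c)
  ultimately show ?thesis using nonneg_square by metis
qed

text \<open>
  If \<open>1 - x\<^sup>2\<close> had a left inverse \<open>b\<close>, then the partial sums of the geometric series for \<open>x\<^sup>2\<close>
  would be bounded by \<open>2 \<parallel>b\<parallel>\<close>; but the first \<open>n\<close> terms dominate \<open>n x\<^sup>2\<^sup>n\<close>, of norm \<open>n\<close>.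
\<close>

lemma one_minus_square_not_left_invertible:
  fixes x :: "'a::unital_cstar_algebra"
  assumes x: "self_adjoint x" "norm x = 1"
  shows "b * (1 - x * x) \<noteq> 1"
proof
  assume b: "b * (1 - x * x) = 1"
  \<comment> \<open>The number of terms is taken to be a power of two, since repeated use of the
    C*-identity gives the norm of \<open>x ^ n\<close> for such exponents.\<close>
  obtain m :: nat where m: "2 * norm b < 2 ^ m" using real_arch_pow[of 2 "2 * norm b"] by auto
  let ?n = "2 ^ m :: nat" let ?y = "x * x"
  let ?S = "\<Sum>k<?n. ?y ^ k"
  have pw: "?y ^ ?n = x ^ ?n * x ^ ?n" by (rule power_square_self[symmetric])
  have ny: "norm (?y ^ ?n) = 1"
    unfolding pw norm_self_adjoint_square[OF self_adjoint_power[OF x(1)]]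
      norm_self_adjoint_power_two[OF x(1)] by (simp add: x)
  have "nonneg (?y ^ ?n)" unfolding pw by (intro nonneg_square self_adjoint_power x)
  then have 1: "nonneg (real ?n *\<^sub>R ?y ^ ?n)" by (rule nonneg_scaleR) simp
  have 2: "nonneg (\<Sum>k<?n. ?y ^ k - ?y ^ ?n)"
    by (intro nonneg_sum nonneg_power_diff) (auto simp: x)
  have "?S = real ?n *\<^sub>R ?y ^ ?n + (\<Sum>k<?n. ?y ^ k - ?y ^ ?n)"
    by (simp add: sum_subtractf scaleR_conv_of_real del: of_nat_power)
  then have "real ?n \<le> norm ?S"
    using nonneg_norm_mono[OF 1 2] ny by simp
  also have "?S = b * ((1 - ?y) * ?S)" by (simp add: b flip: mult.assoc)
  also have "(1 - ?y) * ?S = 1 - ?y ^ ?n" by (rule one_minus_mult_geometric_sum)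
  also have "norm (b * (1 - ?y ^ ?n)) \<le> norm b * norm (1 - ?y ^ ?n)" by (rule norm_mult_ineq)
  also have "\<dots> \<le> norm b * 2"
    using norm_triangle_ineq4[of 1 "?y ^ ?n"] ny by (intro mult_left_mono) auto
  finally show False using m by simp
qed

text \<open>The passage from spectrum to norm. Let \<open>t = norm y\<close> and suppose that
  \<open>x = t - y\<close> had norm \<open>r > t\<close>. Then \<open>r - x = y + (r - t)\<close> is
  left invertible by hypothesis, and \<open>r + x\<close> is invertible because \<open>x\<close> is
  positive. Hence \<open>1 - z * z\<close> is left invertible for \<open>z = x / r\<close> of norm
  1, which is impossible.\<close>

lemma nonneg_if_left_invertible:
  fixes y :: "'a::unital_cstar_algebra"
  assumes y: "self_adjoint y" and inv: "\<And>e. e > 0 \<Longrightarrow> \<exists>b. b * (y + e *\<^sub>R 1) = 1"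
  shows "nonneg y"
proof (rule nonnegI[OF y], rule ccontr)
  let ?t = "norm y" let ?x = "?t *\<^sub>R 1 - y"
  define r where "r = norm ?x"
  assume "\<not> norm ?x \<le> ?t"
  then have r: "r > ?t" "r > 0" by (auto simp: r_def intro: le_less_trans[OF norm_ge_zero])
  obtain b where b: "b * (y + (r - ?t) *\<^sub>R 1) = 1" using inv[of "r - ?t"] r by auto
  have y1: "y + (r - ?t) *\<^sub>R 1 = r *\<^sub>R 1 - ?x" by (simp add: algebra_simps)
  obtain c where c: "self_adjoint c" "c * (?x + r *\<^sub>R 1) = 1" "(?x + r *\<^sub>R 1) * c = 1"
    by (rule nonneg_invertible[OF nonneg_norm_minus[OF y order_refl] r(2)])
  let ?z = "(1 / r) *\<^sub>R ?x"
  have factor: "r\<^sup>2 *\<^sub>R (1 - (1 / r) *\<^sub>R u * (1 / r) *\<^sub>R u) = (r *\<^sub>R 1 - u) * (u + r *\<^sub>R 1)" for u :: 'a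
    using r(2) by (simp add: scaleR_diff_right left_diff_distrib distrib_left power2_eq_square)
  have "(r\<^sup>2 *\<^sub>R (c * b)) * (1 - ?z * ?z) = c * b * (r\<^sup>2 *\<^sub>R (1 - ?z * ?z))"
    by (simp only: mult_scaleR_left mult_scaleR_right)
  also have "\<dots> = c * (b * (r *\<^sub>R 1 - ?x)) * (?x + r *\<^sub>R 1)"
    by (simp only: factor mult.assoc)
  also have "\<dots> = 1" by (simp only: b[unfolded y1] c(2) mult_1_right)
  finally have "(r\<^sup>2 *\<^sub>R (c * b)) * (1 - ?z * ?z) = 1" .
  moreover have "self_adjoint ?z" "norm ?z = 1"
    using r(2) by (auto simp: r_def[symmetric] intro!: self_adjoint_scaleR self_adjoint_diff y)
  ultimately show False using one_minus_square_not_left_invertible by blast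
qed

section \<open>Positivity of \<open>star x * x\<close>\<close>

lemma nonneg_star_mult_swap:
  fixes y :: "'a::unital_cstar_algebra"
  assumes "nonneg (- (star y * y))"
  shows "nonneg (- (y * star y))"
proof (rule nonneg_if_left_invertible)
  show "self_adjoint (- (y * star y))"
    using self_adjoint_star_mult[of "star y"] by (simp add: star_star self_adjoint_minus)
next
  fix e :: real assume e: "e > 0"
  obtain b where b: "self_adjoint b" "b * (- (star y * y) + e *\<^sub>R 1) = 1"
      "(- (star y * y) + e *\<^sub>R 1) * b = 1"
    by (rule nonneg_invertible[OF assms e])
  have bb: "b * (star y * y) = e *\<^sub>R b - 1"
    using b(2) by (simp add: distrib_left algebra_simps)
  \<comment> \<open>The resolvent identity behind the fact that \<open>star y * y\<close> and
    \<open>y * star y\<close> have the same nonzero spectrum: the inverse \<open>b\<close> on one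
    side yields \<open>(1 + y * b * star y) / e\<close> on the other.\<close>
  have "(1 + y * b * star y) * (- (y * star y) + e *\<^sub>R 1)
      = e *\<^sub>R 1 - y * star y + e *\<^sub>R (y * b * star y) - y * (b * (star y * y)) * star y"
    by (simp add: algebra_simps)
  also have "\<dots> = e *\<^sub>R 1" unfolding bb by (simp add: algebra_simps)
  finally have "(1 / e) *\<^sub>R (1 + y * b * star y) * (- (y * star y) + e *\<^sub>R 1) = 1"
    using e by simp
  then show "\<exists>b. b * (- (y * star y) + e *\<^sub>R 1) = 1" by blast
qed

text \<open>Real and imaginary parts exhibit \<open>star y * y + y * star y\<close> as half a sum of
  two squares, hence as positive. If \<open>star y * y\<close> is negative, so is
  \<open>y * star y\<close>; removing the latter from the sum leaves \<open>star y * y\<close>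
  positive as well.\<close>

lemma star_mult_eq_zero_if_nonpos:
  fixes y :: "'a::unital_cstar_algebra"
  assumes "nonneg (- (star y * y))"
  shows "star y * y = 0"
proof -
  let ?a = "y + star y" let ?b = "\<i> *\<^sub>C (y - star y)"
  have sa: "self_adjoint ?a" "self_adjoint ?b"
    by (auto simp: self_adjoint_def star_add star_star star_scaleC star_diff scaleC_minus_left
        scaleC_diff_right)
  have "?a * ?a + ?b * ?b = 2 *\<^sub>R (star y * y + y * star y)"
    by (simp add: mult_scaleC_left mult_scaleC_right scaleC_scaleC scaleC_minus_left
        scaleC_diff_right scaleR_2 algebra_simps)
  moreover have "nonneg (?a * ?a + ?b * ?b)" by (intro nonneg_add nonneg_square sa)
  ultimately have "nonneg (star y * y + y * star y)"
    using nonneg_scaleR[of "?a * ?a + ?b * ?b" "1 / 2"] by simp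
  then have "nonneg ((star y * y + y * star y) + - (y * star y))"
    by (rule nonneg_add[OF _ nonneg_star_mult_swap[OF assms]])
  then have "nonneg (star y * y)" by simp
  then show ?thesis using assms by (rule nonneg_antisym)
qed

text \<open>Here \<open>s\<close> is the absolute value of \<open>c\<close>. Because
  \<open>s\<close> and \<open>c\<close> commute and have equal squares,
  \<open>(s + c + e) * (s - c + e)\<close> collapses to \<open>e (2 s + e)\<close>, which is
  invertible.\<close>

lemma nonneg_abs_minus:
  fixes c s :: "'a::unital_cstar_algebra"
  assumes c: "self_adjoint c" and s: "nonneg s" and sq: "s * s = c * c" and comm: "c * s = s * c"
  shows "nonneg (s - c)"
proof (rule nonneg_if_left_invertible)
  show "self_adjoint (s - c)" by (intro self_adjoint_diff nonneg_self_adjoint s c)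
next
  fix e :: real assume e: "e > 0"
  have s2: "nonneg (2 *\<^sub>R s)" by (rule nonneg_scaleR[OF s]) simp
  obtain b where b: "self_adjoint b" "b * (2 *\<^sub>R s + e *\<^sub>R 1) = 1" "(2 *\<^sub>R s + e *\<^sub>R 1) * b = 1"
    by (rule nonneg_invertible[OF s2 e])
  have "(s + c + e *\<^sub>R 1) * (s - c + e *\<^sub>R 1) = e *\<^sub>R (2 *\<^sub>R s + e *\<^sub>R 1)"
    by (simp add: algebra_simps comm sq scaleR_2)
  then have "b * (s + c + e *\<^sub>R 1) * (s - c + e *\<^sub>R 1) = e *\<^sub>R 1"
    by (simp only: mult.assoc mult_scaleR_right b)
  then have "(1 / e) *\<^sub>R (b * (s + c + e *\<^sub>R 1)) * (s - c + e *\<^sub>R 1) = 1"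
    using e by (simp only: mult_scaleR_left) simp
  then show "\<exists>b. b * (s - c + e *\<^sub>R 1) = 1" by blast
qed

text \<open>
  With \<open>c = x\<^sup>* x\<close> and \<open>s = \<bar>c\<bar>\<close>, the element \<open>y = x (s - c)\<close> satisfies
  \<open>y\<^sup>* y = - (s - c)\<^sup>3 / 2 \<le> 0\<close>, which forces the negative part of \<open>c\<close> to vanish.
\<close>

theorem nonneg_star_mult:
  fixes x :: "'a::unital_cstar_algebra"
  shows "nonneg (star x * x)"
proof -
  define c where "c = star x * x"
  have c: "self_adjoint c" unfolding c_def by (rule self_adjoint_star_mult)
  obtain s where s: "nonneg s" "s * s = c * c"
      "\<forall>z. z * (c * c) = (c * c) * z \<longrightarrow> z * s = s * z"
    by (rule nonneg_sqrt[OF nonneg_square[OF c]])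
  have cs: "c * s = s * c" by (intro s(3)[rule_format]) (simp only: mult.assoc)
  define d where "d = s - c"
  have d: "nonneg d" unfolding d_def by (rule nonneg_abs_minus[OF c s(1,2) cs])
  have dsa: "star d = d" using nonneg_self_adjoint[OF d] by (simp add: self_adjoint_def)
  obtain e where e: "nonneg e" "e * e = d" "\<forall>z. z * d = d * z \<longrightarrow> z * e = e * z"
    by (rule nonneg_sqrt[OF d])
  have comm: "c * c = s * s" "c * (c * z) = s * (s * z)" "c * (s * z) = s * (c * z)" for z
    by (simp_all add: s(2) cs flip: mult.assoc)
  \<comment> \<open>From \<open>d * (s + c) = s * s - c * c = 0\<close> one gets
    \<open>d * s = - d * c\<close>, so \<open>d * d = - 2 d * c\<close>.\<close>
  have dcd: "d * d * d = - (2 *\<^sub>R (d * c * d))"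
    by (simp add: d_def scaleR_2 algebra_simps cs comm)
  have "d * d * d = (e * d) * (e * d)"
    by (simp add: mult.assoc flip: e(2))
  moreover have "self_adjoint (e * d)"
    by (rule self_adjoint_mult_commute[OF e(1)[THEN nonneg_self_adjoint] d[THEN nonneg_self_adjoint]])
      (simp add: mult.assoc flip: e(2))
  ultimately have d3: "nonneg (d * d * d)" by (simp only: nonneg_square)
  have "star (x * d) * (x * d) = d * c * d" by (simp add: star_mult dsa c_def mult.assoc)
  also have "\<dots> = - ((1 / 2) *\<^sub>R (d * d * d))" by (simp add: dcd)
  finally have y: "star (x * d) * (x * d) = - ((1 / 2) *\<^sub>R (d * d * d))" .
  have "nonneg (- (star (x * d) * (x * d)))" unfolding y using nonneg_scaleR[OF d3, of "1/2"] by simp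
  then have "d * d * d = 0" using star_mult_eq_zero_if_nonpos[of "x * d"] y by simp
  then have "norm ((d * d) * (d * d)) = 0" by (simp flip: mult.assoc)
  moreover have "self_adjoint (d * d)"
    by (rule nonneg_self_adjoint[OF nonneg_square[OF nonneg_self_adjoint[OF d]]])
  ultimately have "d = 0"
    using norm_self_adjoint_square[of d] norm_self_adjoint_square[of "d * d"] nonneg_self_adjoint[OF d]
    by simp
  then show ?thesis using s(1) by (simp add: d_def c_def)
qed

section \<open>Comparing positive elements by test elements from an ideal\<close>

text \<open>
  Put \<open>r = (d + \<epsilon>)\<^sup>-\<^sup>1\<^sup>/\<^sup>2\<close> and \<open>e = r c r\<close>. Testing the hypothesis on \<open>z = r e\<close> gives
  \<open>\<parallel>e\<parallel>\<^sup>3 \<le> \<parallel>e\<parallel>\<^sup>2\<close>, that is \<open>e \<le> 1\<close>, and hence \<open>c \<le> d + \<epsilon>\<close>.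
\<close>

lemma nonneg_diff_if_norm_sandwich_le:
  fixes c d :: "'a::unital_cstar_algebra"
  assumes c: "nonneg c" "c \<in> I" and d: "nonneg d" and "\<epsilon> > 0"
    and I: "\<And>u z. z \<in> I \<Longrightarrow> u * z \<in> I" "\<And>u z. z \<in> I \<Longrightarrow> z * u \<in> I"
    and le: "\<And>z. z \<in> I \<Longrightarrow> norm (star z * c * z) \<le> norm (star z * d * z)"
  shows "nonneg (d + \<epsilon> *\<^sub>R 1 - c)"
proof -
  have de: "nonneg (d + \<epsilon> *\<^sub>R 1)"
    using \<open>\<epsilon> > 0\<close> by (intro nonneg_add[OF d] nonneg_scaleR nonnegI[of 1 1]) simp_all
  obtain g where g: "nonneg g" "g * g = d + \<epsilon> *\<^sub>R 1"
      "\<forall>z. z * (d + \<epsilon> *\<^sub>R 1) = (d + \<epsilon> *\<^sub>R 1) * z \<longrightarrow> z * g = g * z"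
    by (rule nonneg_sqrt[OF de])
  obtain b where b: "self_adjoint b" "b * (d + \<epsilon> *\<^sub>R 1) = 1" "(d + \<epsilon> *\<^sub>R 1) * b = 1"
    by (rule nonneg_invertible[OF d \<open>\<epsilon> > 0\<close>])
  have bg: "b * g = g * b" using b by (intro g(3)[rule_format]) simp
  define r where "r = g * b"
  have "r * g = (g * g) * b" by (simp only: r_def mult.assoc bg)
  then have rg: "r * g = 1" by (simp only: g(2) b(3))
  have "g * r = (g * g) * b" by (simp only: r_def mult.assoc)
  then have gr: "g * r = 1" by (simp only: g(2) b(3))
  have r: "star r = r" and gs: "star g = g"
    using nonneg_self_adjoint[OF g(1)] b(1) bg by (simp_all add: r_def self_adjoint_def star_mult)
  obtain k where k: "nonneg k" "k * k = c" "\<forall>z. z * c = c * z \<longrightarrow> z * k = k * z"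
    by (rule nonneg_sqrt[OF c(1)])
  obtain h where h: "nonneg h" "h * h = d" "\<forall>z. z * d = d * z \<longrightarrow> z * h = h * z"
    by (rule nonneg_sqrt[OF d])
  have ks: "star k = k" and hs: "star h = h"
    using nonneg_self_adjoint[OF k(1)] nonneg_self_adjoint[OF h(1)] by (simp_all add: self_adjoint_def)
  define e where "e = r * c * r"
  have "e = star (k * r) * (k * r)" by (simp add: e_def star_mult r ks mult.assoc flip: k(2))
  then have e: "nonneg e" by (simp only: nonneg_star_mult)
  then have es: "star e = e" using nonneg_self_adjoint[OF e] by (simp add: self_adjoint_def)
  \<comment> \<open>The test element contains the factor \<open>c\<close>, so it lies in the ideal
    although \<open>r\<close> need not.\<close>
  have "r * e \<in> I" unfolding e_def by (intro I c)
  then have "norm (star (r * e) * c * (r * e)) \<le> norm (star (r * e) * d * (r * e))" by (rule le)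
  moreover have "star (r * e) * c * (r * e) = e * (r * c * r) * e"
    by (simp only: star_mult es r mult.assoc)
  then have "star (r * e) * c * (r * e) = e * e * e" by (simp only: e_def[symmetric])
  ultimately have e3: "norm (e * e * e) \<le> norm (star (r * e) * d * (r * e))" by simp
  \<comment> \<open>Since \<open>r * (g * g) * r = 1\<close>, the two summands add up to
    \<open>e * e\<close>. Both are positive, the first by way of the root \<open>h\<close> of
    \<open>d\<close>, so dropping the one with \<epsilon> cannot raise the norm.\<close>
  have "star (h * r * e) * (h * r * e) + \<epsilon> *\<^sub>R (star (r * e) * (r * e))
      = e * r * (h * h + \<epsilon> *\<^sub>R 1) * r * e"
    by (simp add: star_mult es r hs distrib_left distrib_right mult.assoc)
  also have "\<dots> = e * (r * g) * (g * r) * e" by (simp only: h(2) mult.assoc flip: g(2))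
  also have "\<dots> = e * e" by (simp add: rg gr)
  finally have "norm (star (h * r * e) * (h * r * e)) \<le> norm (e * e)"
    using nonneg_norm_mono[OF nonneg_star_mult[of "h * r * e"]
        nonneg_scaleR[OF nonneg_star_mult[of "r * e"], of \<epsilon>]] \<open>\<epsilon> > 0\<close>
    by simp
  moreover have "star (h * r * e) * (h * r * e) = star (r * e) * d * (r * e)"
    by (simp add: star_mult hs mult.assoc flip: h(2))
  ultimately have "norm (e * e * e) \<le> (norm e)\<^sup>2"
    using e3 norm_self_adjoint_square[OF nonneg_self_adjoint[OF e]] by simp
  \<comment> \<open>The C*-identity gives the norm of \<open>e ^ 4\<close> but not directly that of
    the cube; one factor \<open>norm e\<close> bridges the two.\<close>
  moreover have "norm e ^ 4 \<le> norm (e * e * e) * norm e"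
  proof -
    have ee: "self_adjoint (e * e)"
      by (rule nonneg_self_adjoint[OF nonneg_square[OF nonneg_self_adjoint[OF e]]])
    have "norm e ^ 4 = norm ((e * e) * (e * e))"
      using norm_self_adjoint_square[OF nonneg_self_adjoint[OF e]]
      by (simp add: norm_self_adjoint_square[OF ee])
    also have "\<dots> = norm (e * e * e * e)" by (simp add: mult.assoc)
    finally show ?thesis using norm_mult_ineq[of "e * e * e" e] by simp
  qed
  ultimately have "norm e ^ 4 \<le> norm e ^ 3"
    using mult_right_mono[of "norm (e * e * e)" "(norm e)\<^sup>2" "norm e"]
    by (simp add: power2_eq_square power3_eq_cube)
  then have "norm e \<le> 1"
    using power_strict_increasing[of 3 4 "norm e"] by (cases "norm e \<le> 1") auto
  then have "nonneg (1 - e)"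
    using nonneg_norm_minus[OF nonneg_self_adjoint[OF e], of 1] by simp
  then obtain q where q: "nonneg q" "q * q = 1 - e" "\<forall>z. z * (1 - e) = (1 - e) * z \<longrightarrow> z * q = q * z"
    by (rule nonneg_sqrt)
  have "star (q * g) * (q * g) = g * (1 - e) * g"
    using nonneg_self_adjoint[OF q(1)] by (simp add: star_mult gs self_adjoint_def mult.assoc flip: q(2))
  also have "\<dots> = g * g - (g * r) * c * (r * g)"
    by (simp only: right_diff_distrib left_diff_distrib e_def mult.assoc mult_1_left mult_1_right)
  also have "\<dots> = d + \<epsilon> *\<^sub>R 1 - c" by (simp add: rg gr g(2))
  finally have "d + \<epsilon> *\<^sub>R 1 - c = star (q * g) * (q * g)" by (rule sym)
  then show ?thesis by (simp only: nonneg_star_mult)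
qed

text \<open>Applying the comparison in both directions places \<open>d + \<epsilon> - c\<close>
  between 0 and 2 \<epsilon>, so \<open>d - c\<close> has norm at most 3 \<epsilon>.\<close>

lemma eq_if_norm_sandwich_eq:
  fixes c d :: "'a::unital_cstar_algebra"
  assumes c: "nonneg c" "c \<in> I" and d: "nonneg d" "d \<in> I"
    and I: "\<And>u z. z \<in> I \<Longrightarrow> u * z \<in> I" "\<And>u z. z \<in> I \<Longrightarrow> z * u \<in> I"
    and eq: "\<And>z. z \<in> I \<Longrightarrow> norm (star z * c * z) = norm (star z * d * z)"
  shows "c = d"
proof -
  have "norm (d - c) \<le> 3 * \<epsilon>" if "\<epsilon> > 0" for \<epsilon>
  proof -
    have 1: "nonneg (d + \<epsilon> *\<^sub>R 1 - c)"
      by (rule nonneg_diff_if_norm_sandwich_le[OF c d(1) that], erule I, erule I) (simp add: eq)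
    have 2: "nonneg (c + \<epsilon> *\<^sub>R 1 - d)"
      by (rule nonneg_diff_if_norm_sandwich_le[OF d c(1) that], erule I, erule I) (simp add: eq)
    have *: "(2 * \<epsilon>) *\<^sub>R 1 - (d + \<epsilon> *\<^sub>R 1 - c) = c + \<epsilon> *\<^sub>R 1 - d"
      by (simp only: mult_2 scaleR_left_distrib) simp
    have "norm (d + \<epsilon> *\<^sub>R 1 - c) \<le> 2 * \<epsilon>"
    proof (rule nonneg_norm_le[OF 1])
      show "nonneg ((2 * \<epsilon>) *\<^sub>R 1 - (d + \<epsilon> *\<^sub>R 1 - c))" unfolding * by (rule 2)
    qed (use that in simp)
    then have "norm (d + \<epsilon> *\<^sub>R 1 - c - \<epsilon> *\<^sub>R 1) \<le> 2 * \<epsilon> + \<epsilon>"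
      using norm_triangle_ineq4[of "d + \<epsilon> *\<^sub>R 1 - c" "\<epsilon> *\<^sub>R (1::'a)"] that by simp
    moreover have "d + \<epsilon> *\<^sub>R 1 - c - \<epsilon> *\<^sub>R 1 = d - c" by simp
    ultimately show ?thesis by simp
  qed
  then have bound: "norm (d - c) \<le> 3 * (\<epsilon> / 3)" if "\<epsilon> > 0" for \<epsilon>
    using that by (meson divide_pos_pos zero_less_numeral)
  have "norm (d - c) \<le> 0 + \<epsilon>" if "\<epsilon> > 0" for \<epsilon>
    using bound[OF that] by simp
  then have "norm (d - c) \<le> 0" by (rule field_le_epsilon)
  then show ?thesis by simp
qed

subsection \<open>Norm equalities\<close>

lemma scalar_part_ops [simp]:
  "scalar_part (u * v) = scalar_part u * scalar_part v" "scalar_part (star u) = cnj (scalar_part u)"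
  by (simp_all add: times_unitization_def star_unitization_def)

abbreviation embed :: "'a::cstar_algebra \<Rightarrow> 'a unitization" where
  "embed \<equiv> Unitization 0"

lemma embed_mult: "embed (x * y) = embed x * embed y"
  by (simp add: times_unitization_def)

lemma embed_star: "embed (star x) = star (embed x)"
  by (simp add: star_unitization_def)

lemma embed_add: "embed (x + y) = embed x + embed y"
  by (simp add: plus_unitization_def)

lemma embed_sum: "embed (sum f S) = (\<Sum>i\<in>S. embed (f i))"
  by (induction S rule: infinite_finite_induct) (simp_all add: embed_add flip: zero_unitization_def)

lemma norm_embed: "norm (embed x) = norm x"
proof (rule antisym)
  show "norm (embed x) \<le> norm x" using norm_unitization_le_add[of "embed x"] by simp
  have "norm x * norm x \<le> norm (embed x) * norm x"
    using norm_unitization_action[of "embed x" "star x"] cstar_identity[of "star x"]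
    by (simp add: unitization_action_def norm_star star_star power2_eq_square)
  then show "norm x \<le> norm (embed x)" by (cases "x = 0") auto
qed

lemma nonneg_embed_star_mult: "nonneg (embed (star x * x))"
  by (simp add: embed_mult embed_star nonneg_star_mult)

lemma nonneg_sandwich:
  fixes d :: "'a::unital_cstar_algebra"
  assumes "nonneg d" shows "nonneg (star z * d * z)"
proof -
  obtain h where h: "nonneg h" "h * h = d" "\<forall>z. z * d = d * z \<longrightarrow> z * h = h * z"
    by (rule nonneg_sqrt[OF assms])
  have "star z * d * z = star (h * z) * (h * z)"
    using nonneg_self_adjoint[OF h(1)]
    by (simp add: self_adjoint_def star_mult mult.assoc flip: h(2))
  then show ?thesis by (simp only: nonneg_star_mult)
qed

text \<open>The spectral hypothesis enters here: \<open>- e\<close> lies outside the spectrum, and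
  negating an inverse of \<open>- e - p\<close> gives a left inverse of
  \<open>p + e\<close>.\<close>

lemma nonneg_embed_if_positive_element:
  assumes "positive_element p" shows "nonneg (embed p)"
proof (rule nonneg_if_left_invertible)
  show "self_adjoint (embed p)"
    using assms by (simp add: positive_element_def self_adjoint_def flip: embed_star)
next
  fix e :: real assume "e > 0"
  then have "complex_of_real (- e) \<notin> complex_of_real ` {0..}"
    by (auto simp del: of_real_minus)
  then have "unitization_invertible (complex_of_real (- e), - p)"
    using assms by (auto simp: positive_element_def spectrum_def)
  then obtain c x where "unitization_mult (c, x) (complex_of_real (- e), - p) = (1, 0)"
    unfolding unitization_invertible_def by (metis surj_pair)
  then have "Unitization (- c) (- x) * (embed p + e *\<^sub>R 1) = 1"
    by (simp add: unitization_mult_def unitization_ops scaleC_minus_left scaleC_minus_right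
        scaleR_conv_of_real)
  then show "\<exists>b. b * (embed p + e *\<^sub>R 1) = 1" by blast
qed

text \<open>The elements with scalar part 0 form an ideal of the unitization that is an isometric
  copy of the algebra, so test elements from the algebra itself suffice.\<close>

lemma eq_if_norm_star_mult_sandwich_eq:
  assumes "nonneg (embed c)" "nonneg (embed d)"
    and "\<And>z. norm (star z * c * z) = norm (star z * d * z)"
  shows "c = d"
proof -
  have "embed c = embed d"
  proof (rule eq_if_norm_sandwich_eq[where I = "{u. scalar_part u = 0}"])
    fix z :: "'a unitization" assume "z \<in> {u. scalar_part u = 0}"
    then have z: "z = embed (alg_part z)" by (simp add: unitization_eq_iff)
    show "norm (star z * embed c * z) = norm (star z * embed d * z)"
      using assms(3)[of "alg_part z"]
      by (subst (1 2 3 4) z) (simp only: norm_embed flip: embed_mult embed_star)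
  qed (simp_all add: assms)
  then show ?thesis by simp
qed

theorem corollary5p3:
  fixes P A :: "nat \<Rightarrow> 'a::cstar_algebra" and m :: nat
  assumes "\<And>j. j \<le> m \<Longrightarrow> positive_element (P j)"
  shows "((\<forall>X :: nat \<Rightarrow> 'a.
            (norm (\<Sum>j=0..m. A j * X j))\<^sup>2 = norm (\<Sum>j=0..m. star (X j) * P j * X j))
          \<longleftrightarrow> (\<forall>j\<le>m. star (A j) * A j = P j) \<and>
              (\<forall>j\<le>m. \<forall>k\<le>m. k \<noteq> j \<longrightarrow> star (A k) * A j = 0))
       \<and> (\<forall>Q. projection Q \<and> (\<forall>j\<le>m. P j = Q) \<and>
              (\<forall>X :: nat \<Rightarrow> 'a.
                (norm (\<Sum>j=0..m. A j * X j))\<^sup>2 = norm (\<Sum>j=0..m. star (X j) * P j * X j))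
            \<longrightarrow> (\<forall>j\<le>m. partial_isometry (A j) \<and> initial_projection (A j) = Q) \<and>
                (\<forall>j\<le>m. \<forall>k\<le>m. k \<noteq> j \<longrightarrow> orthogonal_ranges (A k) (A j)))"
    (is "(?norms \<longleftrightarrow> ?orth) \<and> ?proj")
proof -
  have orth: ?orth if ?norms
  proof -
    have pos: "nonneg (embed (star x * P j * x))" if "j \<le> m" for x j
      using nonneg_sandwich[OF nonneg_embed_if_positive_element[OF assms[OF that]]]
      by (simp only: embed_mult embed_star)
    have gram: "star (\<Sum>j=0..m. A j * X j) * (\<Sum>j=0..m. A j * X j)
        = (\<Sum>j=0..m. star (X j) * P j * X j)" for X
    proof (rule eq_if_norm_star_mult_sandwich_eq)
      show "nonneg (embed (\<Sum>j=0..m. star (X j) * P j * X j))"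
        unfolding embed_sum by (intro nonneg_sum pos) simp
      fix z
      have "norm (star z * (star (\<Sum>j=0..m. A j * X j) * (\<Sum>j=0..m. A j * X j)) * z)
          = (norm ((\<Sum>j=0..m. A j * X j) * z))\<^sup>2"
        by (simp add: star_mult mult.assoc flip: cstar_identity)
      also have "(\<Sum>j=0..m. A j * X j) * z = (\<Sum>j=0..m. A j * (X j * z))"
        by (simp add: sum_distrib_right mult.assoc)
      also have "(norm \<dots>)\<^sup>2 = norm (\<Sum>j=0..m. star (X j * z) * P j * (X j * z))"
        by (rule spec[OF \<open>?norms\<close>, of "\<lambda>j. X j * z"])
      also have "(\<Sum>j=0..m. star (X j * z) * P j * (X j * z))
          = star z * (\<Sum>j=0..m. star (X j) * P j * X j) * z"
        by (simp add: sum_distrib_left sum_distrib_right star_mult mult.assoc)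
      finally show "norm (star z * (star (\<Sum>j=0..m. A j * X j) * (\<Sum>j=0..m. A j * X j)) * z)
          = norm (star z * (\<Sum>j=0..m. star (X j) * P j * X j) * z)" .
    qed (rule nonneg_embed_star_mult)
    \<comment> \<open>Without a unit to insert for \<open>X j\<close>, the Gram identity only gives
      equality after sandwiching with \<open>z\<close>; a second use of the comparison removes
      \<open>z\<close>.\<close>
    have diag: "star (A j) * A j = P j" if j: "j \<le> m" for j
    proof (rule eq_if_norm_star_mult_sandwich_eq)
      fix z
      have "star (A j * z) * (A j * z) = star z * P j * z"
        using gram[of "\<lambda>i. if i = j then z else 0"] j
        by (simp add: if_distrib if_distribR cong: if_cong)
      then show "norm (star z * (star (A j) * A j) * z) = norm (star z * P j * z)"
        by (simp add: star_mult mult.assoc)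
    qed (rule nonneg_embed_star_mult, rule nonneg_embed_if_positive_element[OF assms[OF j]])
    have "star (A k) * A j = 0" if j: "j \<le> m" and k: "k \<le> m" and "k \<noteq> j" for j k
    proof -
      let ?T = "star (A k) * A j"
      \<comment> \<open>These are the cross terms of the Gram identity; the diagonal terms cancel by
        \<open>diag\<close>.\<close>
      have anti: "star x * ?T * y = - (star y * star ?T * x)" for x y
      proof -
        let ?X = "\<lambda>i. if i = k then x else if i = j then y else 0"
        have pick: "(\<Sum>i=0..m. f i (?X i)) = f k x + f j y" if "\<And>i. f i 0 = 0" for f :: "nat \<Rightarrow> 'a \<Rightarrow> 'a"
        proof -
          have "(\<Sum>i=0..m. f i (?X i)) = (\<Sum>i\<in>{k, j}. f i (?X i))"
            using j k that by (intro sum.mono_neutral_right) auto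
          then show ?thesis using \<open>k \<noteq> j\<close> by auto
        qed
        have "star (A k * x + A j * y) * (A k * x + A j * y) = star x * P k * x + star y * P j * y"
          using gram[of ?X] pick[of "\<lambda>i. (*) (A i)"] pick[of "\<lambda>i x. star x * P i * x"] by simp
        then have "star x * ?T * y + star y * star ?T * x = 0"
          by (simp add: star_add star_mult star_star algebra_simps flip: diag[OF j] diag[OF k])
        then show ?thesis by (simp add: eq_neg_iff_add_eq_0)
      qed
      \<comment> \<open>Replacing \<open>y\<close> by \<open>i y\<close> multiplies the left side of
        \<open>anti\<close> by \<open>i\<close> and the right side by \<open>- i\<close>, which
        forces both to vanish.\<close>
      have zero: "star x * ?T * y = 0" for x y
      proof -
        have "\<i> *\<^sub>C (star x * ?T * y) = \<i> *\<^sub>C (star y * star ?T * x)"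
          using anti[of x "\<i> *\<^sub>C y"]
          by (simp add: star_scaleC mult_scaleC_left mult_scaleC_right scaleC_minus_left)
        then have "\<i> *\<^sub>C (star x * ?T * y) = \<i> *\<^sub>C (- (star x * ?T * y))"
          by (simp only: anti[of x y] minus_minus)
        then have "(- \<i>) *\<^sub>C \<i> *\<^sub>C (star x * ?T * y) = (- \<i>) *\<^sub>C \<i> *\<^sub>C (- (star x * ?T * y))"
          by (rule arg_cong)
        then have "star x * ?T * y = - (star x * ?T * y)"
          by (simp only: scaleC_scaleC) simp
        then have "2 *\<^sub>R (star x * ?T * y) = 0" by (simp add: scaleR_2 eq_neg_iff_add_eq_0)
        then show ?thesis by simp
      qed
      \<comment> \<open>In place of units, \<open>x = T * star T\<close> and
        \<open>y = star T\<close> are inserted: then \<open>T * star T\<close> has square 0, and two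
        uses of the C*-identity give \<open>T = 0\<close>.\<close>
      have "norm (?T * star ?T) ^ 2 = norm (star (?T * star ?T) * (?T * star ?T))"
        by (simp only: cstar_identity)
      also have "\<dots> = 0" using zero[of "?T * star ?T" "star ?T"] by (simp add: mult.assoc)
      finally have "norm (star (star ?T) * star ?T) = 0" by (simp only: star_star) simp
      then have "norm (star ?T) = 0" by (simp only: cstar_identity) simp
      then show ?thesis by (simp only: norm_star norm_eq_zero)
    qed
    with diag show ?thesis by blast
  qed
  have norms: ?norms if ?orth
  proof
    fix X :: "nat \<Rightarrow> 'a"
    have "star (\<Sum>j=0..m. A j * X j) * (\<Sum>k=0..m. A k * X k)
        = (\<Sum>j=0..m. \<Sum>k=0..m. star (X j) * (star (A j) * A k) * X k)"
      by (simp add: star_sum sum_product star_mult mult.assoc)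
    also have "\<dots> = (\<Sum>j=0..m. \<Sum>k=0..m. if k = j then star (X j) * P j * X j else 0)"
      using that by (intro sum.cong refl) auto
    also have "\<dots> = (\<Sum>j=0..m. star (X j) * P j * X j)" by simp
    finally show "(norm (\<Sum>j=0..m. A j * X j))\<^sup>2 = norm (\<Sum>j=0..m. star (X j) * P j * X j)"
      by (simp flip: cstar_identity)
  qed
  have proj: ?proj
  proof (intro allI impI, elim conjE)
    fix Q assume Q: "projection Q" "\<forall>j\<le>m. P j = Q" and ?norms
    from orth[OF \<open>?norms\<close>] have AQ: "star (A j) * A j = Q" if "j \<le> m" for j using Q(2) that by auto
    have QQ: "star Q = Q" "Q * Q = Q" using Q(1) by (auto simp: projection_def self_adjoint_def)
    have "partial_isometry (A j)" if j: "j \<le> m" for j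
    proof -
      \<comment> \<open>The defect \<open>A j * Q - A j\<close> vanishes by the C*-identity, so
        \<open>A j * star (A j) * A j = A j * Q = A j\<close>.\<close>
      have "star (A j * Q - A j) * (A j * Q - A j)
          = Q * (star (A j) * A j) * Q - Q * (star (A j) * A j) - (star (A j) * A j) * Q + star (A j) * A j"
        by (simp add: star_diff star_mult QQ algebra_simps)
      also have "\<dots> = 0" by (simp add: AQ[OF j] QQ)
      finally have "norm (A j * Q - A j) = 0" using cstar_identity[of "A j * Q - A j"] by simp
      then show ?thesis by (simp add: partial_isometry_def mult.assoc AQ[OF j])
    qed
    then show "(\<forall>j\<le>m. partial_isometry (A j) \<and> initial_projection (A j) = Q) \<and>
        (\<forall>j\<le>m. \<forall>k\<le>m. k \<noteq> j \<longrightarrow> orthogonal_ranges (A k) (A j))"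
      using AQ orth[OF \<open>?norms\<close>] by (auto simp: initial_projection_def orthogonal_ranges_def)
  qed
  show ?thesis using orth norms proj by blast
qed

end
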